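(* Let $K\ge1$ and $d\ge1$ be integers, let $\rho>F_{1,K+2}$ be real, and put $$\zeta_d=\left\lceil\frac{\rho-F_{d,K}}{F_{d,K+1}}\right\rceil,\qquad \Gamma_1=\zeta_dF_{d,K+1}+F_{d,K},\qquad \Gamma_2=\Gamma_1+F_{d,K+1}.$$ Let $\tau_j$ and $P_j$ ($1\le j\le K+1$) be the layer-$j$ error bound and dynamic range of the two-moduli system with moduli $m\Gamma_1,m\Gamma_2$, where $m>0$ is real. Let $\varphi=\frac{1+\sqrt5}{2}$. Then: 1. The error bounds satisfy $$\frac{\tau_j}{\tau_{j+1}}=\frac{F_{d,K+2-j}}{F_{d,K+1-j}}\to\varphi\qquad(j\text{ fixed},\ K\to\infty).$$ 2. The dynamic ranges satisfy: - $P_2/P_1=\Gamma_2/\Gamma_1$ for $K\ge2$; - $P_1/P_{K+1}\approx 1/F_{d,K+1}$ for $\zeta_d\gg1$; - $P_K/P_{K+1}<1/(d+1)$; - $2<P_{j+2}/P_j<3$ for $1\le j\le K-2$, $K\ge3$; - $P_{j+2}/P_j\to\varphi^2\approx2.618$ as $j\to\infty$ (with $K\ge j+2$).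
   Context: **Fibonacci-like sequence.** For an integer $d\ge0$, $F_{d,0}=d$, $F_{d,1}=1$, and $F_{d,k}=F_{d,k-1}+F_{d,k-2}$ for $k\ge2$. **Layer quantities.** For coprime positive integers $\Gamma_1<\Gamma_2$ and real $m>0$, put $\sigma_{-1}=\Gamma_2$, $\sigma_0=\Gamma_1$, $\sigma_j=\sigma_{j-2}\bmod\sigma_{j-1}$ for $j\ge1$, with $\sigma_{K+1}=1$. The layer-$j$ dynamic range is $P_j=mN_j$, where $N_{-1}=\Gamma_1$, $N_0=\Gamma_2$ and $N_j=N_{j-2}+\lfloor\sigma_{j-1}/\sigma_j\rfloor(N_{j-1}-\sigma_j)$ for $j\ge1$. The layer-$j$ error bound is $\tau_j=m\sigma_j/4$. According to the theorem introducing the construction, the pair $(\Gamma_1,\Gamma_2)$ in the claim satisfies $\gcd(\Gamma_1,\Gamma_2)=1$, $\sigma_j=F_{d,K+2-j}$ for $1\le j\le K+1$ (so $\tau_j=\frac m4F_{d,K+2-j}$), $P_{K+1}=m\Gamma_1\Gamma_2$, and for $1\le j\le K$: $P_j=m\Gamma_1F_{\zeta_d,2j_0}$ if $j=2j_0-1$, and $P_j=m\Gamma_2F_{\zeta_d-1,2j_0+1}$ if $j=2j_0$. The symbols $\approx$ and $\gg$ are used informally: the approximation of $P_1/P_{K+1}$ is the one obtained from $\frac{P_1}{P_{K+1}}=\frac{\zeta_d+1}{(\zeta_d+1)F_{d,K+1}+F_{d,K}}$ by assuming $(\zeta_d+1)F_{d,K+1}\gg F_{d,K}$.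
   Formalization: The condition ζ_d ≥ 1 (equivalently ρ > F_{d,K}) is added; for large d, ρ > F_{1,K+2} alone allows ζ_d = 0 (e.g. K=2, d=10, ρ=6 gives Γ=(11,23), σ_2=0), where the layers up to K+1 do not exist and the claim fails. *)

theory Defs
  imports Complex_Main
begin

fun F :: "nat \<Rightarrow> nat \<Rightarrow> nat" where
  "F d 0 = d"
| "F d (Suc 0) = 1"
| "F d (Suc (Suc k)) = F d (Suc k) + F d k"

text \<open>
  The layer sequences of a pair of moduli start at index \<open>-1\<close>. In \<open>rem_seq\<close> and \<open>range_seq\<close> the
  argument is therefore shifted by one: argument \<open>k\<close> is layer \<open>k - 1\<close>, so that
  \<open>rem_seq G1 G2 (Suc j)\<close> is \<open>\<sigma>\<close> at layer \<open>j\<close> and \<open>range_seq G1 G2 (Suc j)\<close> is \<open>N\<close> at layer \<open>j\<close>.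
  The functions \<open>sigma\<close>, \<open>err_bound\<close> and \<open>dyn_range\<close> use the unshifted layer index.
\<close>

fun rem_seq :: "int \<Rightarrow> int \<Rightarrow> nat \<Rightarrow> int" where
  "rem_seq G1 G2 0 = G2"
| "rem_seq G1 G2 (Suc 0) = G1"
| "rem_seq G1 G2 (Suc (Suc k)) = rem_seq G1 G2 k mod rem_seq G1 G2 (Suc k)"

fun range_seq :: "int \<Rightarrow> int \<Rightarrow> nat \<Rightarrow> int" where
  "range_seq G1 G2 0 = G1"
| "range_seq G1 G2 (Suc 0) = G2"
| "range_seq G1 G2 (Suc (Suc k)) =
     range_seq G1 G2 k
     + (rem_seq G1 G2 (Suc k) div rem_seq G1 G2 (Suc (Suc k)))
       * (range_seq G1 G2 (Suc k) - rem_seq G1 G2 (Suc (Suc k)))"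

definition sigma :: "int \<Rightarrow> int \<Rightarrow> nat \<Rightarrow> int" where
  "sigma G1 G2 j = rem_seq G1 G2 (Suc j)"

definition err_bound :: "real \<Rightarrow> int \<Rightarrow> int \<Rightarrow> nat \<Rightarrow> real" where
  "err_bound m G1 G2 j = m * real_of_int (sigma G1 G2 j) / 4"

definition dyn_range :: "real \<Rightarrow> int \<Rightarrow> int \<Rightarrow> nat \<Rightarrow> real" where
  "dyn_range m G1 G2 j = m * real_of_int (range_seq G1 G2 (Suc j))"

definition zeta :: "nat \<Rightarrow> nat \<Rightarrow> real \<Rightarrow> int" where
  "zeta K d \<rho> = \<lceil>(\<rho> - real (F d K)) / real (F d (K + 1))\<rceil>"

definition Gamma1 :: "nat \<Rightarrow> nat \<Rightarrow> real \<Rightarrow> int" where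
  "Gamma1 K d \<rho> = zeta K d \<rho> * int (F d (K + 1)) + int (F d K)"

definition Gamma2 :: "nat \<Rightarrow> nat \<Rightarrow> real \<Rightarrow> int" where
  "Gamma2 K d \<rho> = Gamma1 K d \<rho> + int (F d (K + 1))"

abbreviation tau :: "nat \<Rightarrow> nat \<Rightarrow> real \<Rightarrow> real \<Rightarrow> nat \<Rightarrow> real" where
  "tau K d \<rho> m j \<equiv> err_bound m (Gamma1 K d \<rho>) (Gamma2 K d \<rho>) j"

abbreviation P :: "nat \<Rightarrow> nat \<Rightarrow> real \<Rightarrow> real \<Rightarrow> nat \<Rightarrow> real" where
  "P K d \<rho> m j \<equiv> dyn_range m (Gamma1 K d \<rho>) (Gamma2 K d \<rho>) j"

text \<open>
  The condition \<open>1 \<le> zeta K d \<rho>\<close> says \<open>F d K < \<rho>\<close>. It is automatic for \<open>d = 1\<close> (and for \<open>K = 1\<close>),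
  but not for large \<open>d\<close>. It is exactly what makes the remainder sequence of the pair reach \<open>1\<close>
  for the first time at layer \<open>K + 1\<close>, i.e. what makes the pair a system with layers up to
  \<open>K + 1\<close>; for \<open>zeta K d \<rho> = 0\<close> the remainder at layer \<open>K\<close> is already \<open>0\<close>.
\<close>

definition admissible :: "nat \<Rightarrow> nat \<Rightarrow> real \<Rightarrow> real \<Rightarrow> bool" where
  "admissible K d \<rho> m \<longleftrightarrow>
     1 \<le> K \<and> 1 \<le> d \<and> real (F 1 (K + 2)) < \<rho> \<and> 1 \<le> zeta K d \<rho> \<and> 0 < m"

definition golden :: real where
  "golden = (1 + sqrt 5) / 2"

end

theory Submission
  imports Defs
begin

text \<open>
  The remainders of the pair are \<open>\<sigma>\<^sub>j = F d (K + 2 - j)\<close>, and the linear recurrence gives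
  \<open>\<Gamma>\<^sub>1 F \<zeta> j - \<Gamma>\<^sub>2 F (\<zeta> - 1) j = (-1)\<^sup>j \<sigma>\<^sub>j\<close>. Since all quotients between layers \<open>2\<close> and \<open>K\<close> are \<open>1\<close>,
  this identity yields the closed form of the ranges by induction. At the last layer the quotient
  is \<open>d + 1\<close>, and \<open>N\<^bsub>K+1\<^esub> = \<Gamma>\<^sub>1 \<Gamma>\<^sub>2\<close> follows from the symmetry in \<open>a, b\<close> of
  \<open>F a k + (b + 1) F a (k + 1)\<close>. All limits come from the identity
  \<open>F a (n + 1) - \<phi> F a n = (1 - \<phi>)\<^sup>n (1 - \<phi> a)\<close>, which gives a rate of convergence
  of the quotients \<open>F a (n + 1) / F a n\<close> that does not depend on \<open>a\<close>.
\<close>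

section \<open>Positivity, monotonicity and symmetry of the sequences \<open>F d\<close>\<close>

lemma F_pos: "0 < n \<Longrightarrow> 0 < F d n"
  by (induction d n rule: F.induct) simp_all

lemma F_less_Suc:
  assumes "1 \<le> d" "1 \<le> n"
  shows "F d n < F d (Suc n)"
proof -
  obtain k where k: "n = Suc k"
    using assms(2) by (cases n) auto
  have "0 < F d k"
    using assms(1) F_pos[of k d] by (cases k) auto
  then show ?thesis
    by (simp add: k)
qed

text \<open>Lets \<open>F d n\<close> absorb the factor \<open>1 - golden * d\<close>, so that error
  bounds become uniform in \<open>d\<close>. It starts at \<open>n = 2\<close> because
  \<open>F d 1 = 1\<close> for every \<open>d\<close>.\<close>

lemma F_ge: "2 \<le> n \<Longrightarrow> d + 1 \<le> F d n"
proof (induction n rule: nat_induct_at_least)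
  case base
  then show ?case by (simp add: numeral_2_eq_2)
next
  case (Suc n)
  then obtain k where "n = Suc k"
    by (cases n) auto
  with Suc show ?case by simp
qed

text \<open>Both sides obey the Fibonacci recurrence in \<open>k\<close>, so the values at
  \<open>k = 0\<close> and \<open>k = 1\<close> decide: they are \<open>a + b + 1\<close> and
  \<open>1 + (a + 1) * (b + 1)\<close>.\<close>

lemma F_symmetric: "F a k + (b + 1) * F a (Suc k) = F b k + (a + 1) * F b (Suc k)"
proof (induction k rule: induct_nat_012)
  case (ge2 n)
  then show ?case
    by (simp add: algebra_simps)
qed (simp_all add: algebra_simps)

section \<open>The golden ratio as limit of quotients\<close>

lemma golden_squared: "golden\<^sup>2 = golden + 1"
  by (simp add: golden_def power2_eq_square field_simps)

lemma golden_bounds: "1.6175 < golden" "golden < 1.6185"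
proof -
  have "2.235 < sqrt 5"
    by (rule real_less_rsqrt) (simp add: power2_eq_square)
  then show "1.6175 < golden"
    by (simp add: golden_def)
  have "sqrt 5 < 2.237"
    by (rule real_less_lsqrt) (simp_all add: power2_eq_square)
  then show "golden < 1.6185"
    by (simp add: golden_def)
qed

lemma F_Suc_minus_golden:
  "real (F d (Suc n)) - golden * real (F d n) = (1 - golden) ^ n * (1 - golden * real d)"
proof (induction n)
  case (Suc n)
  \<comment> \<open>One step multiplies the defect by \<open>1 - golden\<close>, the other root of
    \<open>x^2 = x + 1\<close>; the extra term has coefficient zero by
    \<open>golden_squared\<close>.\<close>
  have "real (F d (Suc (Suc n))) - golden * real (F d (Suc n)) =
      (1 - golden) * (real (F d (Suc n)) - golden * real (F d n)) +
      (golden + 1 - golden\<^sup>2) * real (F d n)"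
    by (simp add: algebra_simps power2_eq_square)
  then show ?case
    by (simp add: Suc golden_squared)
qed simp

text \<open>The constant 2 comes from \<open>golden < 2\<close> together with
  \<open>d + 1 \<le> F d n\<close>. It is the same for all \<open>d\<close>.\<close>

lemma F_quotient_golden:
  assumes "2 \<le> n"
  shows "\<bar>real (F d (Suc n)) / real (F d n) - golden\<bar> \<le> 2 * (golden - 1) ^ n"
proof -
  have pos: "0 < real (F d n)"
    using assms F_pos[of n d] by simp
  have "real d + 1 \<le> real (F d n)"
    using F_ge[OF assms, of d] by linarith
  moreover have "golden * real d \<le> 2 * real d"
    using golden_bounds by (intro mult_right_mono) auto
  moreover have "0 \<le> golden * real d"
    using golden_bounds by simp
  ultimately have bound: "\<bar>1 - golden * real d\<bar> \<le> 2 * real (F d n)"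
    by linarith
  have "real (F d (Suc n)) / real (F d n) - golden =
      (1 - golden) ^ n * (1 - golden * real d) / real (F d n)"
    using pos by (simp flip: F_Suc_minus_golden add: field_simps)
  also have "\<bar>\<dots>\<bar> = (golden - 1) ^ n * \<bar>1 - golden * real d\<bar> / real (F d n)"
    using golden_bounds by (simp add: abs_mult power_abs)
  also have "\<dots> \<le> (golden - 1) ^ n * (2 * real (F d n)) / real (F d n)"
    using golden_bounds bound by (intro divide_right_mono mult_left_mono) auto
  finally show ?thesis
    using pos by simp
qed

text \<open>The starting value \<open>d k\<close> may vary with \<open>k\<close>; this freedom is
  needed for the ranges, where it is \<open>zeta\<close> or \<open>zeta - 1\<close>.\<close>

lemma F_quotient_tendsto:
  assumes "filterlim n at_top sequentially"
  shows "(\<lambda>k. real (F (d k) (Suc (n k))) / real (F (d k) (n k))) \<longlonglongrightarrow> golden"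
proof -
  have "(\<lambda>i. (golden - 1) ^ i) \<longlonglongrightarrow> 0"
    using golden_bounds by (intro LIMSEQ_power_zero) simp
  then have "(\<lambda>k. 2 * (golden - 1) ^ n k) \<longlonglongrightarrow> 0"
    using tendsto_mult_right_zero filterlim_compose[OF _ assms] by blast
  moreover have "\<forall>\<^sub>F k in sequentially.
      norm (real (F (d k) (Suc (n k))) / real (F (d k) (n k)) - golden) \<le>
      norm (2 * (golden - 1) ^ n k) * 1"
    using filterlim_at_top[THEN iffD1, OF assms, rule_format, of 2]
  proof eventually_elim
    case (elim k)
    then show ?case
      using F_quotient_golden[of "n k" "d k"] golden_bounds by (simp add: abs_mult)
  qed
  ultimately have "(\<lambda>k. real (F (d k) (Suc (n k))) / real (F (d k) (n k)) - golden) \<longlonglongrightarrow> 0"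
    by (rule tendsto_0_le)
  then show ?thesis
    by (rule LIM_zero_cancel)
qed

section \<open>Remainders of the pair of moduli, with \<open>z\<close> for \<open>zeta\<close> as a
  natural number\<close>

locale fibonacci_moduli =
  fixes K d z :: nat
  assumes K_pos: "1 \<le> K" and d_pos: "1 \<le> d" and z_pos: "1 \<le> z"
begin

definition G1 :: int where "G1 = int (z * F d (K + 1) + F d K)"

definition G2 :: int where "G2 = G1 + int (F d (K + 1))"

lemma G1_pos: "0 < G1"
  using F_pos[of K d] K_pos unfolding G1_def of_nat_0_less_iff by simp

lemma G2_pos: "0 < G2"
  using G1_pos by (simp add: G2_def del: F.simps)

text \<open>The Euclidean algorithm runs backwards through \<open>F d\<close>: as long as
  \<open>F d k < F d (k + 1)\<close>, reducing \<open>F d (k + 2)\<close> modulo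
  \<open>F d (k + 1)\<close> leaves \<open>F d k\<close>.\<close>

lemma sigma_eq:
  assumes "1 \<le> j" "j \<le> K + 1"
  shows "sigma G1 G2 j = int (F d (K + 2 - j))"
proof -
  have less: "int (F d K) < int (F d (K + 1))"
    using F_less_Suc[OF d_pos K_pos] by simp
  \<comment> \<open>With \<open>z \<ge> 1\<close>, \<open>F d (K + 1)\<close> is smaller than
    \<open>G1\<close>, hence it is the remainder of \<open>G2 = G1 + F d (K + 1)\<close> modulo
    \<open>G1\<close>.\<close>
  have "int (F d (K + 1)) \<le> int z * int (F d (K + 1))"
    using z_pos by (simp add: mult_le_cancel_right1)
  then have "int (F d (K + 1)) < G1"
    using F_pos[of K d] K_pos by (simp add: G1_def)
  then have s1: "sigma G1 G2 1 = int (F d (K + 1))"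
    by (simp add: sigma_def G2_def)
  have "sigma G1 G2 (Suc 1) = G1 mod sigma G1 G2 1"
    by (simp add: sigma_def)
  also have "\<dots> = G1 mod int (F d (K + 1))"
    by (simp only: s1)
  also have "\<dots> = int (F d K)"
    using less by (simp add: G1_def)
  finally have s2: "sigma G1 G2 (Suc 1) = int (F d K)" .
  have "i \<le> K \<Longrightarrow> sigma G1 G2 (Suc i) = int (F d (K + 1 - i))" for i
  proof (induction i rule: induct_nat_012)
    case (ge2 i)
    define k where "k = K - Suc i"
    \<comment> \<open>\<open>1 \<le> k\<close> matters: \<open>F d 0 = d\<close> need not lie below
      \<open>F d 1 = 1\<close>, so the pattern stops at layer \<open>K + 1\<close>.\<close>
    have k: "K + 1 - i = Suc (Suc k)" "K + 1 - Suc i = Suc k" "K + 1 - Suc (Suc i) = k" "1 \<le> k"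
      using ge2.prems by (auto simp: k_def)
    have "sigma G1 G2 (Suc (Suc (Suc i))) = sigma G1 G2 (Suc i) mod sigma G1 G2 (Suc (Suc i))"
      by (simp add: sigma_def)
    also have "\<dots> = int (F d (Suc (Suc k))) mod int (F d (Suc k))"
      using ge2 k by simp
    also have "\<dots> = int (F d k)"
      using F_less_Suc[OF d_pos k(4)] by simp
    finally show ?case
      by (simp only: k)
  qed (use s1 s2 in simp_all)
  from this[of "j - 1"] show ?thesis
    using assms by (cases j) auto
qed

text \<open>Both sides obey the Fibonacci recurrence in \<open>j\<close>: on the right, the
  alternating sign turns \<open>F d k = F d (k + 2) - F d (k + 1)\<close> into a sum.\<close>

lemma combination_eq:
  "j \<le> K + 2 \<Longrightarrow>
    G1 * int (F z j) - G2 * int (F (z - 1) j) = (-1) ^ j * int (F d (K + 2 - j))"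
proof (induction j rule: induct_nat_012)
  case 0
  have "int (F (z - 1) 0) = int z - 1"
    using z_pos by simp
  then show ?case
    by (simp add: G1_def G2_def algebra_simps)
next
  case 1
  then show ?case
    by (simp add: G2_def)
next
  case (ge2 j)
  define k where "k = K - j"
  have k: "K + 2 - j = Suc (Suc k)" "K + 2 - Suc j = Suc k" "K + 2 - Suc (Suc j) = k"
    using ge2.prems by (auto simp: k_def)
  show ?case
    using ge2 unfolding k by (simp add: algebra_simps)
qed

section \<open>Closed form of the dynamic ranges\<close>

definition N :: "nat \<Rightarrow> int" where "N j = range_seq G1 G2 (Suc j)"

lemma N_rec:
  "N (Suc (Suc j)) =
    N j + (sigma G1 G2 (Suc j) div sigma G1 G2 (Suc (Suc j))) * (N (Suc j) - sigma G1 G2 (Suc (Suc j)))"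
  by (simp add: N_def sigma_def)

text \<open>\<open>modulus\<close> and \<open>seed\<close> merge the odd and even cases of the range
  formula into one, which also covers layer 0.\<close>

definition modulus :: "nat \<Rightarrow> int" where "modulus j = (if odd j then G1 else G2)"

definition seed :: "nat \<Rightarrow> nat" where "seed j = (if odd j then z else z - 1)"

lemma seed_Suc_Suc: "seed (Suc (Suc j)) = seed j"
  by (simp add: seed_def)

lemma modulus_Suc_Suc: "modulus (Suc (Suc j)) = modulus j"
  by (simp add: modulus_def)

lemma modulus_pos: "0 < modulus j"
  using G1_pos G2_pos by (simp add: modulus_def)

text \<open>The parity choice absorbs the sign in \<open>combination_eq\<close>, so passing from one
  modulus to the other always costs the same remainder.\<close>

lemma modulus_alternate:
  assumes "j \<le> K + 2"
  shows "modulus (Suc j) * int (F (seed (Suc j)) j) =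
    modulus j * int (F (seed j) j) + int (F d (K + 2 - j))"
  using combination_eq[OF assms] by (cases "even j") (simp_all add: modulus_def seed_def)

lemma N_eq: "j \<le> K \<Longrightarrow> N j = modulus j * int (F (seed j) (Suc j))"
proof (induction j rule: induct_nat_012)
  case 0
  then show ?case
    by (simp add: N_def modulus_def seed_def)
next
  case 1
  have "F d K < F d (K + 1)"
    using F_less_Suc[OF d_pos K_pos] by simp
  then have "G1 div int (F d (K + 1)) = int z"
    by (simp add: G1_def)
  moreover have "N 1 = G1 + G1 div sigma G1 G2 1 * (G2 - sigma G1 G2 1)"
    by (simp add: N_def sigma_def)
  ultimately show ?case
    using sigma_eq[of 1] by (simp add: G2_def modulus_def seed_def algebra_simps)
next
  case (ge2 j)
  define k where "k = K - Suc (Suc j)"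
  have k: "K + 2 - Suc j = Suc (Suc (Suc k))" "K + 2 - Suc (Suc j) = Suc (Suc k)"
    using ge2.prems by (auto simp: k_def)
  have s: "sigma G1 G2 (Suc j) = int (F d (Suc (Suc (Suc k))))"
      "sigma G1 G2 (Suc (Suc j)) = int (F d (Suc (Suc k)))"
    using ge2.prems sigma_eq[of "Suc j"] sigma_eq[of "Suc (Suc j)"] k by simp_all
  \<comment> \<open>\<open>F d (k + 3)\<close> is the sum of \<open>F d (k + 2)\<close> and a
    smaller number, so the quotient is 1.\<close>
  have "int (F d (Suc k)) < int (F d (Suc (Suc k)))" "0 < int (F d (Suc (Suc k)))"
    using F_less_Suc[OF d_pos, of "Suc k"] F_pos[of "Suc (Suc k)" d] by simp_all
  then have "(int (F d (Suc k)) + int (F d (Suc (Suc k)))) div int (F d (Suc (Suc k))) = 1"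
    by (simp del: F.simps)
  then have "sigma G1 G2 (Suc j) div sigma G1 G2 (Suc (Suc j)) = 1"
    unfolding s F.simps(3)[of d "Suc k"] by (simp only: of_nat_add add.commute)
  then have "N (Suc (Suc j)) = N j + (N (Suc j) - int (F d (Suc (Suc k))))"
    using N_rec[of j] s(2) by simp
  \<comment> \<open>Subtracting the remainder moves \<open>N (j + 1)\<close> to the modulus and seed
    of layer \<open>j\<close>; adding \<open>N j\<close> is then one Fibonacci step.\<close>
  moreover have "modulus j * int (F (seed j) (Suc (Suc j))) + int (F d (Suc (Suc k))) =
      modulus (Suc j) * int (F (seed (Suc j)) (Suc (Suc j)))"
    using modulus_alternate[of "Suc (Suc j)"] ge2.prems k(2)
    by (simp add: modulus_Suc_Suc seed_Suc_Suc del: F.simps)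
  ultimately show ?case
    using ge2 by (simp add: modulus_Suc_Suc seed_Suc_Suc algebra_simps)
qed

lemma N_last: "N (K + 1) = modulus K * (int (F (seed K) K) + (int d + 1) * int (F (seed K) (Suc K)))"
proof -
  obtain k where k: "Suc k = K"
    using K_pos by (cases K) auto
  have "sigma G1 G2 K = int d + 1" "sigma G1 G2 (Suc K) = 1"
    using sigma_eq[of K] sigma_eq[of "Suc K"] K_pos by (simp_all add: numeral_2_eq_2)
  then have "N (K + 1) = N k + (int d + 1) * (N K - 1)"
    using N_rec[of k, unfolded k] by simp
  \<comment> \<open>Layer \<open>K - 1\<close> has the other parity; rewriting it over
    \<open>modulus K\<close> leaves \<open>F d 2 = d + 1\<close>, which cancels against the
    subtracted \<open>(d + 1) * 1\<close>.\<close>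
  moreover have "N k = modulus K * int (F (seed K) K) + (int d + 1)"
  proof -
    have "N k = modulus (Suc K) * int (F (seed (Suc K)) K)"
      using N_eq[of k] k modulus_Suc_Suc[of k, unfolded k] seed_Suc_Suc[of k, unfolded k] by simp
    also have "\<dots> = modulus K * int (F (seed K) K) + (int d + 1)"
      using modulus_alternate[of K] by (simp add: numeral_2_eq_2)
    finally show ?thesis .
  qed
  ultimately show ?thesis
    using N_eq[of K] by (simp add: algebra_simps del: F.simps)
qed

lemma N_last_eq: "N (K + 1) = G1 * G2"
proof -
  have "int (F (seed K) K) + (int d + 1) * int (F (seed K) (Suc K)) =
      int (F (seed K) K + (d + 1) * F (seed K) (Suc K))"
    by (simp only: of_nat_add of_nat_mult of_nat_1)
  \<comment> \<open>After the swap the second factor is whichever of \<open>G1\<close> and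
    \<open>G2\<close> is not \<open>modulus K\<close>.\<close>
  also have "\<dots> = int (F d K + (seed K + 1) * F d (Suc K))"
    by (simp only: F_symmetric)
  also have "\<dots> = (if odd K then G2 else G1)"
    using z_pos by (simp add: seed_def G1_def G2_def algebra_simps del: F.simps)
  finally show ?thesis
    unfolding N_last by (simp add: modulus_def)
qed

lemma N_1: "N 1 = G1 * (int z + 1)"
  using N_eq[of 1] K_pos by (simp add: modulus_def seed_def)

lemma N_2: "2 \<le> K \<Longrightarrow> N 2 = G2 * (int z + 1)"
  using N_eq[of 2] z_pos by (simp add: modulus_def seed_def numeral_2_eq_2 algebra_simps)

lemma N_last_greater: "(int d + 1) * N K < N (K + 1)"
proof -
  have "0 < modulus K * int (F (seed K) K)"
    using modulus_pos F_pos K_pos by simp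
  then show ?thesis
    unfolding N_last by (simp add: N_eq algebra_simps del: F.simps)
qed

text \<open>Layers \<open>j\<close> and \<open>j + 2\<close> share modulus and seed, so the modulus
  cancels and \<open>F (j + 3) / F (j + 1)\<close> splits by the recurrence.\<close>

lemma N_step_two:
  assumes "j + 2 \<le> K"
  shows "real_of_int (N (j + 2)) / real_of_int (N j) =
    real (F (seed j) (Suc (Suc j))) / real (F (seed j) (Suc j)) + 1"
proof -
  have "N (j + 2) = modulus j * int (F (seed j) (Suc (Suc j)) + F (seed j) (Suc j))"
    using N_eq[of "Suc (Suc j)"] assms by (simp add: modulus_Suc_Suc seed_Suc_Suc)
  moreover have "N j = modulus j * int (F (seed j) (Suc j))"
    using N_eq assms by simp
  ultimately show ?thesis
    using modulus_pos[of j] F_pos[of "Suc j" "seed j"]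
    by (simp add: add_divide_distrib del: F.simps)
qed

lemma N_step_two_bounds:
  assumes "1 \<le> j" "j + 2 \<le> K"
  shows "2 < real_of_int (N (j + 2)) / real_of_int (N j)"
    and "real_of_int (N (j + 2)) / real_of_int (N j) < 3"
proof -
  obtain i where i: "j = Suc i"
    using assms(1) by (cases j) auto
  \<comment> \<open>For \<open>i = 0\<close> the layer is \<open>j = 1\<close>, whose seed is
    \<open>z\<close>, not \<open>z - 1\<close>, and hence positive.\<close>
  have "0 < F (seed j) i"
    using F_pos[of i] z_pos i by (cases i) (simp_all add: seed_def)
  moreover have "0 < F (seed j) j"
    using F_pos i by simp
  ultimately show "2 < real_of_int (N (j + 2)) / real_of_int (N j)"
    and "real_of_int (N (j + 2)) / real_of_int (N j) < 3"
    unfolding N_step_two[OF assms(2)] by (simp_all add: i field_simps)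
qed

end

section \<open>Transfer to error bounds and ranges over the reals\<close>

lemma admissible_moduli:
  assumes "admissible K d \<rho> m"
  shows "fibonacci_moduli K d (nat (zeta K d \<rho>))"
    and "Gamma1 K d \<rho> = fibonacci_moduli.G1 K d (nat (zeta K d \<rho>))"
    and "Gamma2 K d \<rho> = fibonacci_moduli.G2 K d (nat (zeta K d \<rho>))"
proof -
  show "fibonacci_moduli K d (nat (zeta K d \<rho>))"
    using assms by unfold_locales (auto simp: admissible_def)
  then interpret fibonacci_moduli K d "nat (zeta K d \<rho>)" .
  show "Gamma1 K d \<rho> = G1"
    using assms by (simp add: Gamma1_def G1_def admissible_def)
  then show "Gamma2 K d \<rho> = G2"
    by (simp add: Gamma2_def G2_def)
qed

lemma P_quotient:
  assumes "admissible K d \<rho> m"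
  shows "P K d \<rho> m i / P K d \<rho> m j =
    real_of_int (fibonacci_moduli.N K d (nat (zeta K d \<rho>)) i) /
    real_of_int (fibonacci_moduli.N K d (nat (zeta K d \<rho>)) j)"
proof -
  interpret fibonacci_moduli K d "nat (zeta K d \<rho>)"
    by (rule admissible_moduli[OF assms])
  show ?thesis
    using assms
    by (simp add: dyn_range_def N_def admissible_moduli(2,3)[OF assms] admissible_def)
qed

lemma tau_quotient:
  assumes "admissible K d \<rho> m" "1 \<le> j" "j \<le> K"
  shows "tau K d \<rho> m j / tau K d \<rho> m (j + 1) = real (F d (K + 2 - j)) / real (F d (K + 1 - j))"
proof -
  interpret fibonacci_moduli K d "nat (zeta K d \<rho>)"
    by (rule admissible_moduli[OF assms(1)])
  show ?thesis
    using assms sigma_eq[of j] sigma_eq[of "j + 1"]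
    by (simp add: err_bound_def admissible_moduli(2,3)[OF assms(1)] admissible_def)
qed

lemma tau_quotient_tendsto:
  assumes "1 \<le> j" "\<And>K. j \<le> K \<Longrightarrow> admissible K d (\<rho>s K) m"
  shows "(\<lambda>K. tau K d (\<rho>s K) m j / tau K d (\<rho>s K) m (j + 1)) \<longlonglongrightarrow> golden"
proof -
  have "filterlim (\<lambda>K. K + 1 - j) at_top sequentially"
    unfolding filterlim_at_top eventually_sequentially by (metis add_le_imp_le_diff trans_le_add1)
  then have "(\<lambda>K. real (F d (Suc (K + 1 - j))) / real (F d (K + 1 - j))) \<longlonglongrightarrow> golden"
    by (rule F_quotient_tendsto)
  moreover have "\<forall>\<^sub>F K in sequentially. real (F d (Suc (K + 1 - j))) / real (F d (K + 1 - j)) =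
      tau K d (\<rho>s K) m j / tau K d (\<rho>s K) m (j + 1)"
    using eventually_ge_at_top[of j]
  proof eventually_elim
    case (elim K)
    then have "Suc (K + 1 - j) = K + 2 - j"
      by simp
    then show ?case
      using tau_quotient[OF assms(2)[OF elim] assms(1) elim] by (simp only:)
  qed
  ultimately show ?thesis
    by (rule Lim_transform_eventually)
qed

lemma P_2_P_1:
  assumes "admissible K d \<rho> m" "2 \<le> K"
  shows "P K d \<rho> m 2 / P K d \<rho> m 1 = real_of_int (Gamma2 K d \<rho>) / real_of_int (Gamma1 K d \<rho>)"
proof -
  interpret fibonacci_moduli K d "nat (zeta K d \<rho>)"
    by (rule admissible_moduli[OF assms(1)])
  show ?thesis
    unfolding P_quotient[OF assms(1)]
    unfolding N_1 N_2[OF assms(2)] admissible_moduli(2,3)[OF assms(1)]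
    by simp
qed

text \<open>\<open>G1\<close> cancels from \<open>G1 * (z + 1)\<close> over \<open>G1 * G2\<close>,
  and the denominator is \<open>G2\<close> written out.\<close>

lemma P_1_P_last:
  assumes "admissible K d \<rho> m"
  shows "P K d \<rho> m 1 / P K d \<rho> m (K + 1) =
    (real_of_int (zeta K d \<rho>) + 1) /
    ((real_of_int (zeta K d \<rho>) + 1) * real (F d (K + 1)) + real (F d K))"
proof -
  interpret fibonacci_moduli K d "nat (zeta K d \<rho>)"
    by (rule admissible_moduli[OF assms])
  have z: "1 \<le> zeta K d \<rho>"
    using assms by (simp add: admissible_def)
  have "real_of_int G2 = (real_of_int (zeta K d \<rho>) + 1) * real (F d (K + 1)) + real (F d K)"
    using z by (simp add: G1_def G2_def algebra_simps del: F.simps)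
  then show ?thesis
    unfolding P_quotient[OF assms] N_1 N_last_eq using G1_pos z by (simp del: F.simps)
qed

text \<open>Makes the informal approximation precise as a relative error. The error is exactly
  \<open>b / (x * a + b)\<close>, and \<open>b \<le> a\<close> bounds it by
  \<open>1 / x\<close>.\<close>

lemma P_1_P_last_approx:
  assumes "admissible K d \<rho> m"
  shows "\<bar>(P K d \<rho> m 1 / P K d \<rho> m (K + 1)) / (1 / real (F d (K + 1))) - 1\<bar>
    \<le> 1 / (real_of_int (zeta K d \<rho>) + 1)"
proof -
  define x where "x = real_of_int (zeta K d \<rho>) + 1"
  define a where "a = real (F d (K + 1))"
  define b where "b = real (F d K)"
  have x: "0 < x" and a: "0 < a" and b: "0 < b" "b \<le> a"
    using assms F_pos[of K d] F_pos[of "K + 1" d] F_less_Suc[of d K]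
    by (auto simp: x_def a_def b_def admissible_def simp del: F.simps)
  then have pos: "0 < x * a + b"
    by (intro add_pos_pos mult_pos_pos)
  have "x / (x * a + b) / (1 / a) - 1 = - (b / (x * a + b))"
    using pos by (simp add: field_simps)
  also have "\<bar>\<dots>\<bar> = b / (x * a + b)"
    using pos b by simp
  also have "\<dots> \<le> 1 / x"
  proof -
    have "b * x \<le> x * a + b"
      using x b by (simp add: mult.commute add_increasing2)
    then show ?thesis
      using pos x by (simp add: divide_le_eq le_divide_eq)
  qed
  finally show ?thesis
    unfolding P_1_P_last[OF assms] x_def a_def b_def .
qed

lemma P_1_P_last_approx_eventually:
  assumes "0 < \<epsilon>"
  shows "\<exists>Z::int. \<forall>K d \<rho> m. admissible K d \<rho> m \<and> Z \<le> zeta K d \<rho> \<longrightarrow>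
    \<bar>(P K d \<rho> m 1 / P K d \<rho> m (K + 1)) / (1 / real (F d (K + 1))) - 1\<bar> < \<epsilon>"
\<comment> \<open>The threshold depends on \<open>\<epsilon>\<close> alone, so the approximation is
  uniform in all parameters.\<close>
proof (intro exI[of _ "\<lceil>1 / \<epsilon>\<rceil>"] allI impI, elim conjE)
  fix K d \<rho> m
  assume adm: "admissible K d \<rho> m" and "\<lceil>1 / \<epsilon>\<rceil> \<le> zeta K d \<rho>"
  then have "1 / \<epsilon> < real_of_int (zeta K d \<rho>) + 1"
    by linarith
  moreover have "0 < real_of_int (zeta K d \<rho>) + 1"
    using adm by (simp add: admissible_def)
  ultimately have "1 / (real_of_int (zeta K d \<rho>) + 1) < \<epsilon>"
    using assms by (simp add: divide_less_eq mult.commute)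
  with P_1_P_last_approx[OF adm]
  show "\<bar>(P K d \<rho> m 1 / P K d \<rho> m (K + 1)) / (1 / real (F d (K + 1))) - 1\<bar> < \<epsilon>"
    by (rule le_less_trans)
qed

lemma P_K_P_last:
  assumes "admissible K d \<rho> m"
  shows "P K d \<rho> m K / P K d \<rho> m (K + 1) < 1 / (real d + 1)"
proof -
  interpret fibonacci_moduli K d "nat (zeta K d \<rho>)"
    by (rule admissible_moduli[OF assms])
  have "real_of_int ((int d + 1) * N K) < real_of_int (N (K + 1))"
    using N_last_greater by (simp only: of_int_less_iff)
  moreover have "0 < real_of_int (N (K + 1))"
    using N_last_eq G1_pos G2_pos by simp
  ultimately show ?thesis
    unfolding P_quotient[OF assms] by (simp add: field_simps)
qed

lemma P_step_two_bounds:
  assumes "admissible K d \<rho> m" "1 \<le> j" "j + 2 \<le> K"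
  shows "2 < P K d \<rho> m (j + 2) / P K d \<rho> m j \<and> P K d \<rho> m (j + 2) / P K d \<rho> m j < 3"
proof -
  interpret fibonacci_moduli K d "nat (zeta K d \<rho>)"
    by (rule admissible_moduli[OF assms(1)])
  show ?thesis
    unfolding P_quotient[OF assms(1)] using N_step_two_bounds[OF assms(2,3)] by blast
qed

lemma P_step_two_tendsto:
  assumes "\<And>j. 1 \<le> j \<Longrightarrow> j + 2 \<le> Ks j" "\<And>j. 1 \<le> j \<Longrightarrow> admissible (Ks j) d (\<rho>s j) m"
  shows "(\<lambda>j. P (Ks j) d (\<rho>s j) m (j + 2) / P (Ks j) d (\<rho>s j) m j) \<longlonglongrightarrow> golden\<^sup>2"
proof -
  \<comment> \<open>The seed changes with \<open>j\<close> through both parity and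
    \<open>zeta\<close>; the uniform rate of convergence copes with this.\<close>
  define a where "a j = fibonacci_moduli.seed (nat (zeta (Ks j) d (\<rho>s j))) j" for j
  have "(\<lambda>j. real (F (a j) (Suc (Suc j))) / real (F (a j) (Suc j))) \<longlonglongrightarrow> golden"
    using F_quotient_tendsto[OF filterlim_Suc] .
  then have "(\<lambda>j. real (F (a j) (Suc (Suc j))) / real (F (a j) (Suc j)) + 1) \<longlonglongrightarrow> golden + 1"
    by (intro tendsto_intros)
  moreover have "\<forall>\<^sub>F j in sequentially.
      real (F (a j) (Suc (Suc j))) / real (F (a j) (Suc j)) + 1 =
      P (Ks j) d (\<rho>s j) m (j + 2) / P (Ks j) d (\<rho>s j) m j"
    using eventually_ge_at_top[of 1]
  proof eventually_elim
    case (elim j)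
    note adm = assms(2)[OF elim]
    interpret fibonacci_moduli "Ks j" d "nat (zeta (Ks j) d (\<rho>s j))"
      by (rule admissible_moduli[OF adm])
    show ?case
      unfolding P_quotient[OF adm] a_def N_step_two[OF assms(1)[OF elim]] ..
  qed
  ultimately show ?thesis
    unfolding golden_squared by (rule Lim_transform_eventually)
qed

theorem corollary2:
  shows
    "(\<forall>K d \<rho> m j. admissible K d \<rho> m \<and> 1 \<le> j \<and> j \<le> K \<longrightarrow>
        tau K d \<rho> m j / tau K d \<rho> m (j + 1) = real (F d (K + 2 - j)) / real (F d (K + 1 - j))) \<and>
     (\<forall>d m j \<rho>s. 1 \<le> j \<and> (\<forall>K\<ge>j. admissible K d (\<rho>s K) m) \<longrightarrow>
        (\<lambda>K. tau K d (\<rho>s K) m j / tau K d (\<rho>s K) m (j + 1)) \<longlonglongrightarrow> golden) \<and>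
     (\<forall>K d \<rho> m. admissible K d \<rho> m \<and> 2 \<le> K \<longrightarrow>
        P K d \<rho> m 2 / P K d \<rho> m 1 = real_of_int (Gamma2 K d \<rho>) / real_of_int (Gamma1 K d \<rho>)) \<and>
     (\<forall>K d \<rho> m. admissible K d \<rho> m \<longrightarrow>
        P K d \<rho> m 1 / P K d \<rho> m (K + 1) =
          (real_of_int (zeta K d \<rho>) + 1) /
          ((real_of_int (zeta K d \<rho>) + 1) * real (F d (K + 1)) + real (F d K))) \<and>
     (\<forall>\<epsilon>>0. \<exists>Z::int. \<forall>K d \<rho> m. admissible K d \<rho> m \<and> Z \<le> zeta K d \<rho> \<longrightarrow>
        \<bar>(P K d \<rho> m 1 / P K d \<rho> m (K + 1)) / (1 / real (F d (K + 1))) - 1\<bar> < \<epsilon>) \<and>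
     (\<forall>K d \<rho> m. admissible K d \<rho> m \<longrightarrow>
        P K d \<rho> m K / P K d \<rho> m (K + 1) < 1 / (real d + 1)) \<and>
     (\<forall>K d \<rho> m j. admissible K d \<rho> m \<and> 3 \<le> K \<and> 1 \<le> j \<and> j \<le> K - 2 \<longrightarrow>
        2 < P K d \<rho> m (j + 2) / P K d \<rho> m j \<and> P K d \<rho> m (j + 2) / P K d \<rho> m j < 3) \<and>
     (\<forall>d m Ks \<rho>s. (\<forall>j\<ge>1. j + 2 \<le> Ks j \<and> admissible (Ks j) d (\<rho>s j) m) \<longrightarrow>
        (\<lambda>j. P (Ks j) d (\<rho>s j) m (j + 2) / P (Ks j) d (\<rho>s j) m j) \<longlonglongrightarrow> golden\<^sup>2) \<and>
     \<bar>golden\<^sup>2 - 2.618\<bar> < 0.0005"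
proof (intro conjI allI impI; (elim conjE)?)
  \<comment> \<open>The bounds 1.6175 and 1.6185 on \<open>golden\<close>, shifted by 1, are exactly
    2.618 minus and plus 0.0005.\<close>
  show "\<bar>golden\<^sup>2 - 2.618\<bar> < 0.0005"
    using golden_bounds unfolding golden_squared abs_less_iff by simp
next
  fix d m j \<rho>s
  assume "1 \<le> j" "\<forall>K\<ge>j. admissible K d (\<rho>s K) m"
  then show "(\<lambda>K. tau K d (\<rho>s K) m j / tau K d (\<rho>s K) m (j + 1)) \<longlonglongrightarrow> golden"
    using tau_quotient_tendsto by blast
next
  fix d m Ks \<rho>s
  assume "\<forall>j\<ge>1. j + 2 \<le> Ks j \<and> admissible (Ks j) d (\<rho>s j) m"
  then show "(\<lambda>j. P (Ks j) d (\<rho>s j) m (j + 2) / P (Ks j) d (\<rho>s j) m j) \<longlonglongrightarrow> golden\<^sup>2"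
    using P_step_two_tendsto by blast
next
  fix K d \<rho> m j
  assume "admissible K d \<rho> m" "3 \<le> K" "1 \<le> j" "j \<le> K - 2"
  then have "2 < P K d \<rho> m (j + 2) / P K d \<rho> m j \<and> P K d \<rho> m (j + 2) / P K d \<rho> m j < 3"
    by (intro P_step_two_bounds) auto
  then show "2 < P K d \<rho> m (j + 2) / P K d \<rho> m j" "P K d \<rho> m (j + 2) / P K d \<rho> m j < 3"
    by blast+
qed (fact tau_quotient P_2_P_1 P_1_P_last P_1_P_last_approx_eventually P_K_P_last)+

end
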